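(* Let $\phi = \frac{1+\sqrt{5}}{2}$. The following hold. (1) There is no positive integer $n$ such that either $L(n) < L(n+1) < L(n+2)$ or $L(n) > L(n+1) > L(n+2)$. (2) The set of positive integers $n$ such that $n+1$ is a divot of $L$ (that is, $L(n) > L(n+1) < L(n+2)$) is $$S_2 := \left\{2\left\lfloor \frac{k+1}{\phi}\right\rfloor + 3k - 1 \,:\, k\in\mathbb{Z},\ k\ge 1\right\}.$$ (3) The set of positive integers $n$ such that $n+1$ is a peak of $L$ (that is, $L(n) < L(n+1) > L(n+2)$) is $$S_3 := \left\{3\left\lfloor \frac{k}{\phi}+\phi\right\rfloor + 5k \,:\, k\in\mathbb{Z},\ k\ge 0\right\}.$$
   Context: The Fibonacci sequence is defined by $F_0 = 0$, $F_1 = 1$, and $F_n = F_{n-1}+F_{n-2}$ for $n\ge 2$. By Zeckendorf's theorem, every positive integer $n$ can be written uniquely as $n = \sum_{i=1}^{k} F_{c_i}$ with $k \ge 1$, $c_1\ge 2$, and $c_i \ge c_{i-1}+2$ for $2\le i\le k$; this is the Zeckendorf partition of $n$. Let $L(n) := k$ be the number of summands in the Zeckendorf partition of $n$. For a positive integer $n$: $n+1$ is called a divot of $L$ if $L(n) > L(n+1) < L(n+2)$ (i.e. $L(n)>L(n+1)$ and $L(n+1)<L(n+2)$), and $n+1$ is called a peak of $L$ if $L(n) < L(n+1) > L(n+2)$ (i.e. $L(n)<L(n+1)$ and $L(n+1)>L(n+2)$). *)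

theory Defs
  imports Complex_Main "HOL-Number_Theory.Fib"
begin

text \<open>
  A partition is given by the list of its indices: \<open>cs ! (i - 1)\<close> is the index \<open>c\<^sub>i\<close>.
\<close>

definition zeckendorf_partition :: "nat \<Rightarrow> nat list \<Rightarrow> bool" where
  "zeckendorf_partition n cs \<longleftrightarrow>
     length cs \<ge> 1 \<and> cs ! 0 \<ge> 2 \<and>
     (\<forall>i. 1 \<le> i \<and> i < length cs \<longrightarrow> cs ! i \<ge> cs ! (i - 1) + 2) \<and>
     n = (\<Sum>i<length cs. fib (cs ! i))"

text \<open>
  The description is meaningful for \<open>n > 0\<close> only, where the partition exists and is unique
  by Zeckendorf's theorem; \<open>L 0\<close> is unspecified.
\<close>

definition L :: "nat \<Rightarrow> nat" where
  "L n = length (THE cs. zeckendorf_partition n cs)"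

definition divot :: "nat \<Rightarrow> bool" where
  "divot m \<longleftrightarrow> (\<exists>n > 0. m = n + 1 \<and> L n > L (n + 1) \<and> L (n + 1) < L (n + 2))"

definition peak :: "nat \<Rightarrow> bool" where
  "peak m \<longleftrightarrow> (\<exists>n > 0. m = n + 1 \<and> L n < L (n + 1) \<and> L (n + 1) > L (n + 2))"

definition golden_ratio :: real where
  "golden_ratio = (1 + sqrt 5) / 2"

definition S2 :: "int set" where
  "S2 = {2 * \<lfloor>(real_of_int k + 1) / golden_ratio\<rfloor> + 3 * k - 1 |k :: int. k \<ge> 1}"

definition S3 :: "int set" where
  "S3 = {3 * \<lfloor>real_of_int k / golden_ratio + golden_ratio\<rfloor> + 5 * k |k :: int. k \<ge> 0}"

end

theory Submission
  imports Defs
begin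

text \<open>
  Everything follows from the carry rule for adding 1 to a Zeckendorf partition.  If the smallest
  index is at least 4, the summand \<open>F\<^sub>2\<close> is simply put in front and \<open>L\<close> rises by 1.  If the smallest
  index is 2 or 3, the first summand becomes \<open>F\<^sub>3\<close> or \<open>F\<^sub>4\<close>, and then \<open>F\<^sub>c + F\<^sub>c\<^sub>+\<^sub>1 = F\<^sub>c\<^sub>+\<^sub>2\<close> is used as
  long as consecutive indices occur; every such step lowers the number of summands by 1 and raises
  the smallest index by 2.  Hence
  \<^item> \<open>L(n) < L(n+1)\<close> iff the partition of \<open>n\<close> has smallest index at least 4, and then the partition
    of \<open>n+1\<close> starts with index 2 (\<open>L_less_Suc_iff\<close>, \<open>incr_ge4\<close>);
  \<^item> \<open>L(n) > L(n+1)\<close> iff the partition of \<open>n+1\<close> has smallest index at least 5 (\<open>L_Suc_less_iff\<close>).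
  These two facts exclude monotone runs of length three.  They also say that the divots are the
  numbers with smallest index at least 5, and that \<open>n+1\<close> is a peak iff \<open>n\<close> has smallest index
  exactly 4.

  The floors come from lowering all indices by one.  If \<open>k\<close> is the sum of the \<open>F\<^sub>e\<close>, let \<open>\<sigma>(k)\<close> be the
  sum of the \<open>F\<^sub>e\<^sub>-\<^sub>1\<close>.  The difference \<open>k/\<phi> - \<sigma>(k)\<close> is minus the sum of the powers \<open>(-1/\<phi>)\<^sup>e\<close>, and
  because the indices are sparse this sum is so small that \<open>\<sigma>(k) = \<lfloor>(k+1)/\<phi>\<rfloor>\<close>
  (\<open>floor_divide_golden_ratio\<close>).  A number with all indices at least 5 arises by raising the indices
  of some \<open>k \<ge> 1\<close> by 3, so it equals \<open>3k + 2\<sigma>(k)\<close> (\<open>fib_sum_raise\<close>); the elements of \<open>S2\<close> are the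
  predecessors of these divots.  A number with smallest index 4 is \<open>F\<^sub>4 = 3\<close> plus a number whose
  indices are those of some \<open>k \<ge> 0\<close> raised by 4, so it equals \<open>3 + 5k + 3\<sigma>(k)\<close>.
\<close>

section \<open>Sparse index lists\<close>

primrec sparse :: "nat \<Rightarrow> nat list \<Rightarrow> bool" where
  "sparse a [] \<longleftrightarrow> True"
| "sparse a (c # cs) \<longleftrightarrow> a \<le> c \<and> sparse (c + 2) cs"

definition fib_sum :: "nat list \<Rightarrow> nat" where
  "fib_sum cs = (\<Sum>c\<leftarrow>cs. fib c)"

lemma fib_sum_simps [simp]:
  "fib_sum [] = 0"
  "fib_sum (c # cs) = fib c + fib_sum cs"
  by (simp_all add: fib_sum_def)

lemma sparse_mono: "sparse a cs \<Longrightarrow> b \<le> a \<Longrightarrow> sparse b cs"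
  by (cases cs) auto

lemma sparse_iff_nth:
  "sparse a cs \<longleftrightarrow> (cs \<noteq> [] \<longrightarrow> a \<le> cs ! 0) \<and>
     (\<forall>i. 1 \<le> i \<and> i < length cs \<longrightarrow> cs ! i \<ge> cs ! (i - 1) + 2)"
proof -
  have "sparse a cs \<longleftrightarrow> (cs \<noteq> [] \<longrightarrow> a \<le> cs ! 0) \<and>
     (\<forall>i. Suc i < length cs \<longrightarrow> cs ! i + 2 \<le> cs ! Suc i)"
  proof (induction cs arbitrary: a)
    case (Cons c cs)
    then show ?case
      by (cases cs) (simp_all add: All_less_Suc2)
  qed simp
  also have "(\<forall>i. Suc i < length cs \<longrightarrow> cs ! i + 2 \<le> cs ! Suc i) \<longleftrightarrow>
     (\<forall>i. 1 \<le> i \<and> i < length cs \<longrightarrow> cs ! i \<ge> cs ! (i - 1) + 2)"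
    by (auto simp: Suc_le_eq gr0_conv_Suc)
  finally show ?thesis .
qed

lemma zeckendorf_partition_iff:
  "zeckendorf_partition n cs \<longleftrightarrow> cs \<noteq> [] \<and> sparse 2 cs \<and> n = fib_sum cs"
  unfolding zeckendorf_partition_def sparse_iff_nth fib_sum_def
  by (auto simp: sum_list_sum_nth atLeast0LessThan Suc_le_eq)

lemma fib_sum_pos: "sparse 2 cs \<Longrightarrow> cs \<noteq> [] \<Longrightarrow> fib_sum cs > 0"
  by (cases cs) (auto simp: fib_neq_0_nat)

section \<open>Adding one with carries\<close>

text \<open>
  The partition of \<open>F\<^sub>c\<close> plus a number whose indices all exceed \<open>c\<close>: the summands \<open>F\<^sub>c\<close> and \<open>F\<^sub>c\<^sub>+\<^sub>1\<close>
  merge into \<open>F\<^sub>c\<^sub>+\<^sub>2\<close>, which may in turn have a neighbour \<open>F\<^sub>c\<^sub>+\<^sub>3\<close>.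
\<close>

fun carry :: "nat \<Rightarrow> nat list \<Rightarrow> nat list" where
  "carry c [] = [c]"
| "carry c (d # ds) = (if d = c + 1 then carry (c + 2) ds else c # d # ds)"

lemma sparse_carry: "sparse (c + 1) ds \<Longrightarrow> sparse c (carry c ds)"
proof (induction c ds rule: carry.induct)
  case (2 c d ds)
  show ?case
  proof (cases "d = c + 1")
    case True
    with 2 have "sparse (c + 2) (carry (c + 2) ds)"
      by (auto simp: numeral_eq_Suc)
    with True show ?thesis
      by (auto intro: sparse_mono)
  qed (use 2 in auto)
qed simp

lemma fib_sum_carry: "fib_sum (carry c ds) = fib c + fib_sum ds"
  by (induction c ds rule: carry.induct) auto

lemma length_carry_le: "length (carry c ds) \<le> Suc (length ds)"
  by (induction c ds rule: carry.induct) (auto split: if_splits)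

text \<open>
  A carry is visible both in the number of summands and in the smallest index.  This is what
  translates the behaviour of \<open>L\<close> at \<open>n\<close> into a condition on the partition of \<open>n+1\<close>.
\<close>

lemma length_carry_iff:
  assumes "sparse (c + 1) ds"
  shows "length (carry c ds) \<le> length ds \<longleftrightarrow> sparse (c + 2) (carry c ds)"
    and "sparse (c + 1) (carry c ds) \<longleftrightarrow> sparse (c + 2) (carry c ds)"
proof -
  have "carry c ds = c # ds \<or>
        length (carry c ds) \<le> length ds \<and> sparse (c + 2) (carry c ds)"
  proof (cases ds)
    case (Cons d es)
    show ?thesis
    proof (cases "d = c + 1")
      case True
      then have "sparse (c + 2) (carry (c + 2) es)"
        using assms Cons by (intro sparse_carry) (simp add: numeral_eq_Suc)
      with True Cons length_carry_le[of "c + 2" es] show ?thesis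
        by simp
    qed (simp add: Cons)
  qed simp
  then show "length (carry c ds) \<le> length ds \<longleftrightarrow> sparse (c + 2) (carry c ds)"
    and "sparse (c + 1) (carry c ds) \<longleftrightarrow> sparse (c + 2) (carry c ds)"
    by (auto intro: sparse_mono)
qed

text \<open>
  The summand 1 is \<open>F\<^sub>2\<close>; it cannot stand next to an index 2 or 3, where \<open>F\<^sub>2 + 1 = F\<^sub>3\<close> and
  \<open>F\<^sub>3 + 1 = F\<^sub>4\<close> are used instead.
\<close>

definition incr :: "nat list \<Rightarrow> nat list" where
  "incr cs = (if cs \<noteq> [] \<and> hd cs \<in> {2, 3} then carry (hd cs + 1) (tl cs) else 2 # cs)"

text \<open>
  Either 1 can be put in front without a conflict, or the first summand \<open>F\<^sub>b\<^sub>-\<^sub>1\<close> has to be replaced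
  by \<open>F\<^sub>b\<close> when 1 is added.
\<close>

lemma sparse_2_cases:
  assumes "sparse 2 cs"
  obtains (ge4) "sparse 4 cs"
  | (low) b ds where "b \<in> {3, 4}" "sparse (b + 1) ds" "cs = (b - 1) # ds"
proof (cases cs)
  case Nil
  then show thesis by (intro ge4) simp
next
  case (Cons c ds)
  consider "c = 2" | "c = 3" | "c \<ge> 4"
    using assms Cons by fastforce
  then show thesis
  proof cases
    case 1
    then show thesis using assms Cons low[of 3 ds] by simp
  next
    case 2
    then show thesis using assms Cons low[of 4 ds] by simp
  next
    case 3
    then show thesis using assms Cons by (intro ge4) simp
  qed
qed

lemma incr_ge4 [simp]: "sparse 4 cs \<Longrightarrow> incr cs = 2 # cs"
  by (cases cs) (auto simp: incr_def)

lemma incr_low: "b \<in> {3, 4} \<Longrightarrow> incr ((b - 1) # ds) = carry b ds"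
  by (auto simp: incr_def numeral_eq_Suc)

lemma fib_pred_add_one: "b \<in> {3, 4} \<Longrightarrow> fib b = fib (b - 1) + 1"
  by (auto simp: numeral_eq_Suc)

lemma sparse_incr:
  assumes "sparse 2 cs"
  shows "sparse 2 (incr cs)"
  using assms
proof (cases rule: sparse_2_cases)
  case (low b ds)
  from low(1) have "2 \<le> b"
    by auto
  then show ?thesis
    unfolding low(3) incr_low[OF low(1)]
    using sparse_carry[OF low(2)] by (rule sparse_mono[rotated])
qed simp_all

lemma fib_sum_incr:
  assumes "sparse 2 cs"
  shows "fib_sum (incr cs) = Suc (fib_sum cs)"
  using assms
proof (cases rule: sparse_2_cases)
  case (low b ds)
  then show ?thesis
    unfolding low(3) incr_low[OF low(1)] by (simp add: fib_sum_carry fib_pred_add_one)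
qed simp_all

text \<open>
  Undoing carries: \<open>F\<^sub>c\<close> is split into \<open>F\<^sub>c\<^sub>-\<^sub>2 + F\<^sub>c\<^sub>-\<^sub>1\<close> until the smallest index is 3 or 4, where
  subtracting 1 is possible.
\<close>

lemma carry_from_3_or_4:
  assumes "c \<ge> 3" "sparse (c + 1) ds"
  shows "\<exists>b\<in>{3, 4}. \<exists>es. sparse (b + 1) es \<and> carry b es = carry c ds"
  using assms
proof (induction c arbitrary: ds rule: less_induct)
  case (less c)
  show ?case
  proof (cases "c \<in> {3, 4}")
    case True
    with less.prems show ?thesis by blast
  next
    case False
    with less.prems have "c \<ge> 5" by auto
    then obtain c' where c': "c = c' + 2" "c' \<ge> 3"
      by (intro that[of "c - 2"]) linarith+
    then have "carry c' (Suc c' # ds) = carry c ds" "sparse (c' + 1) (Suc c' # ds)"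
      using less.prems by simp_all
    then show ?thesis
      using less.IH[of c' "Suc c' # ds"] c' by simp
  qed
qed

text \<open>
  Every nonempty sparse list is a successor.  Together with \<open>fib_sum_incr\<close> this gives the uniqueness
  part of Zeckendorf's theorem by counting down to the empty list.
\<close>

lemma incr_surj:
  assumes "sparse 2 cs" "cs \<noteq> []"
  obtains ds where "sparse 2 ds" "incr ds = cs"
proof -
  from assms obtain c cs' where cs: "cs = c # cs'" "c \<ge> 2" "sparse (c + 2) cs'"
    by (cases cs) auto
  show thesis
  proof (cases "c = 2")
    case True
    with cs have "sparse 4 cs'" by simp
    then show thesis
      using that[of cs'] True cs sparse_mono[of 4 cs' 2] by simp
  next
    case False
    have "carry c cs' = cs"
      using cs by (cases cs') auto
    moreover have "\<exists>b\<in>{3, 4}. \<exists>es. sparse (b + 1) es \<and> carry b es = carry c cs'"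
      using False cs sparse_mono[of "c + 2" cs' "c + 1"] by (intro carry_from_3_or_4) simp_all
    ultimately obtain b es where "b \<in> {3, 4}" "sparse (b + 1) es" "carry b es = cs"
      by metis
    then show thesis
      using that[of "(b - 1) # es"] incr_low[of b es] by auto
  qed
qed

section \<open>Zeckendorf partitions and the function \<open>L\<close>\<close>

primrec zeck :: "nat \<Rightarrow> nat list" where
  "zeck 0 = []"
| "zeck (Suc n) = incr (zeck n)"

lemma sparse_zeck: "sparse 2 (zeck n)"
  by (induction n) (simp_all add: sparse_incr)

lemma fib_sum_zeck [simp]: "fib_sum (zeck n) = n"
  by (induction n) (simp_all add: fib_sum_incr sparse_zeck)

lemma zeck_fib_sum: "sparse 2 cs \<Longrightarrow> zeck (fib_sum cs) = cs"
proof (induction "fib_sum cs" arbitrary: cs)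
  case 0
  then show ?case
    using fib_sum_pos[of cs] by fastforce
next
  case (Suc n)
  then have "cs \<noteq> []" by auto
  with Suc.prems obtain ds where ds: "sparse 2 ds" "incr ds = cs"
    using incr_surj by metis
  with Suc.hyps(2) have "n = fib_sum ds"
    using fib_sum_incr by auto
  with Suc.hyps(1)[of ds] ds have "zeck n = ds"
    by simp
  with ds Suc.hyps(2) show ?case
    by (metis zeck.simps(2))
qed

lemma L_eq_length_zeck:
  assumes "n > 0"
  shows "L n = length (zeck n)"
proof -
  have "zeck n \<noteq> []"
    using assms fib_sum_zeck[of n] by (auto simp del: fib_sum_zeck)
  then have "zeckendorf_partition n cs \<longleftrightarrow> cs = zeck n" for cs
    unfolding zeckendorf_partition_iff using sparse_zeck zeck_fib_sum fib_sum_zeck by metis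
  then show ?thesis
    by (simp add: L_def)
qed

lemma length_incr_iff:
  assumes "sparse 2 cs"
  shows "length cs < length (incr cs) \<longleftrightarrow> sparse 4 cs"
    and "length (incr cs) < length cs \<longleftrightarrow> sparse 5 (incr cs)"
proof -
  show "length cs < length (incr cs) \<longleftrightarrow> sparse 4 cs"
    using assms
  proof (cases rule: sparse_2_cases)
    case (low b ds)
    then have "\<not> sparse 4 cs" by auto
    with length_carry_le[of b ds] show ?thesis
      unfolding low(3) incr_low[OF low(1)] by simp
  qed simp
  show "length (incr cs) < length cs \<longleftrightarrow> sparse 5 (incr cs)"
    using assms
  proof (cases rule: sparse_2_cases)
    case (low b ds)
    then have "length (incr cs) < length cs \<longleftrightarrow> length (carry b ds) \<le> length ds"
      unfolding low(3) incr_low[OF low(1)] by (simp add: less_Suc_eq_le)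
    also have "\<dots> \<longleftrightarrow> sparse (b + 2) (carry b ds)"
      using low by (simp add: length_carry_iff(1))
    \<comment> \<open>The smallest index is 3 or at least 5 if \<open>b = 3\<close>, and 4 or at least 6 if \<open>b = 4\<close>.\<close>
    also have "\<dots> \<longleftrightarrow> sparse 5 (carry b ds)"
      using low(1) length_carry_iff(2)[OF low(2)] by auto
    finally show ?thesis
      unfolding low(3) incr_low[OF low(1)] .
  qed simp
qed

lemma L_less_Suc_iff: "n > 0 \<Longrightarrow> L n < L (Suc n) \<longleftrightarrow> sparse 4 (zeck n)"
  using length_incr_iff(1)[OF sparse_zeck, of n] by (simp add: L_eq_length_zeck)

lemma L_Suc_less_iff: "n > 0 \<Longrightarrow> L (Suc n) < L n \<longleftrightarrow> sparse 5 (zeck (Suc n))"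
  using length_incr_iff(2)[OF sparse_zeck, of n] by (simp add: L_eq_length_zeck)

text \<open>A fall is always followed by a rise.\<close>

lemma divot_Suc_iff: "n > 0 \<Longrightarrow> divot (Suc n) \<longleftrightarrow> sparse 5 (zeck (Suc n))"
  using L_Suc_less_iff[of n] L_less_Suc_iff[of "Suc n"] sparse_mono[of 5 "zeck (Suc n)" 4]
  by (auto simp: divot_def)

text \<open>
  A rise leads to a partition that starts with 2, and adding 1 again starts carrying at 3; this
  merges summands exactly if the next index is 4.
\<close>

lemma peak_Suc_iff:
  assumes "n > 0"
  shows "peak (Suc n) \<longleftrightarrow> (\<exists>ds. zeck n = 4 # ds)"
proof -
  have "peak (Suc n) \<longleftrightarrow> sparse 4 (zeck n) \<and> sparse 5 (incr (incr (zeck n)))"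
    using assms L_less_Suc_iff[of n] L_Suc_less_iff[of "Suc n"] by (auto simp: peak_def)
  also have "\<dots> \<longleftrightarrow> sparse 4 (zeck n) \<and> sparse 5 (carry 3 (zeck n))"
    using incr_low[of 3] by auto
  also have "\<dots> \<longleftrightarrow> (\<exists>ds. zeck n = 4 # ds)"
  proof (cases "zeck n")
    case (Cons d ds)
    then show ?thesis
      using sparse_carry[of 5 ds] sparse_zeck[of n] by auto
  qed simp
  finally show ?thesis .
qed

section \<open>Lowering the indices and the golden ratio\<close>

definition lowered_sum :: "nat list \<Rightarrow> nat" where
  "lowered_sum cs = (\<Sum>c\<leftarrow>cs. fib (c - 1))"

lemma lowered_sum_simps [simp]:
  "lowered_sum [] = 0"
  "lowered_sum (c # cs) = fib (c - 1) + lowered_sum cs"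
  by (simp_all add: lowered_sum_def)

definition \<rho> :: real where "\<rho> = 1 / golden_ratio"

lemma golden_ratio_pos: "golden_ratio > 0"
  by (simp add: golden_ratio_def add_pos_nonneg)

lemma golden_ratio_eq: "golden_ratio = 1 + \<rho>"
proof -
  have "golden_ratio * golden_ratio = golden_ratio + 1"
    by (simp add: golden_ratio_def field_simps)
  with golden_ratio_pos show ?thesis
    by (simp add: \<rho>_def field_simps)
qed

lemma rho_bounds: "0 < \<rho>" "\<rho> < 1"
proof -
  show "0 < \<rho>"
    using golden_ratio_pos by (simp add: \<rho>_def)
  then have "1 < golden_ratio"
    using golden_ratio_eq by linarith
  then show "\<rho> < 1"
    by (simp add: \<rho>_def)
qed

lemma rho_square: "\<rho> * \<rho> = 1 - \<rho>"
proof -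
  have "\<rho> * golden_ratio = 1"
    using golden_ratio_pos by (simp add: \<rho>_def)
  then show ?thesis
    unfolding golden_ratio_eq by (simp add: algebra_simps)
qed

text \<open>The interval from \<open>-1\<close> to \<open>1 + \<rho> = \<phi>\<close> is mapped by \<open>x \<mapsto> 1 + \<rho>\<^sup>2 x\<close> into itself.\<close>

lemma rho_square_times_bounds:
  assumes "- 1 < x" "x < 1 + \<rho>"
  shows "\<rho> - 1 < \<rho> * \<rho> * x" "\<rho> * \<rho> * x < \<rho>"
proof -
  have sq: "0 < \<rho> * \<rho>"
    using rho_bounds by simp
  have "\<rho> * \<rho> * (- 1) < \<rho> * \<rho> * x"
    using assms(1) sq by (rule mult_strict_left_mono)
  then show "\<rho> - 1 < \<rho> * \<rho> * x"
    using rho_square by simp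
  have "\<rho> * \<rho> * x < \<rho> * \<rho> * (1 + \<rho>)"
    using assms(2) sq by (rule mult_strict_left_mono)
  also have "\<rho> * \<rho> * (1 + \<rho>) = \<rho> * (\<rho> + \<rho> * \<rho>)"
    by (simp only: algebra_simps)
  also have "\<dots> = \<rho>"
    unfolding rho_square by simp
  finally show "\<rho> * \<rho> * x < \<rho>" .
qed

text \<open>The error of the approximation \<open>F\<^sub>n \<approx> F\<^sub>n\<^sub>+\<^sub>1/\<phi>\<close>; \<open>-\<rho>\<close> is the conjugate of \<open>\<phi>\<close>.\<close>

lemma fib_times_rho: "real (fib (Suc n)) * \<rho> - real (fib n) = - ((- \<rho>) ^ Suc n)"
proof (induction n)
  case (Suc n)
  have "real (fib (Suc (Suc n))) * \<rho> - real (fib (Suc n))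
        = real (fib n) * \<rho> - real (fib (Suc n)) * (1 - \<rho>)"
    by (simp add: algebra_simps)
  also have "\<dots> = - \<rho> * (real (fib (Suc n)) * \<rho> - real (fib n))"
    unfolding rho_square[symmetric] by (simp add: algebra_simps)
  also have "\<dots> = - ((- \<rho>) ^ Suc (Suc n))"
    unfolding Suc.IH by simp
  finally show ?case .
qed simp

lemma lowered_sum_error:
  "sparse 1 cs \<Longrightarrow> real (fib_sum cs) * \<rho> - real (lowered_sum cs) = - (\<Sum>c\<leftarrow>cs. (- \<rho>) ^ c)"
proof (induction cs)
  case (Cons c cs)
  then obtain n where "c = Suc n"
    by (cases c) auto
  moreover have "sparse 1 cs"
    using Cons.prems sparse_mono[of "c + 2" cs 1] by auto
  ultimately show ?case
    using Cons.IH fib_times_rho[of n] by (simp add: algebra_simps)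
qed simp

text \<open>
  A sum of powers of \<open>-\<rho>\<close> over sparse exponents is governed by its smallest possible exponent \<open>a\<close>.
  Factoring out \<open>(-\<rho>)\<^sup>a\<close> makes the bounds independent of the parity of \<open>a\<close>.  They are
  the extreme cases, the series over the exponents \<open>a + 1, a + 3, \<dots>\<close> and \<open>a, a + 2, \<dots>\<close>:
  \<open>-\<rho> - \<rho>\<^sup>3 - \<dots> = -1\<close> and \<open>1 + \<rho>\<^sup>2 + \<dots> = 1/\<rho> = 1 + \<rho>\<close>.
\<close>

lemma sparse_power_sum:
  "sparse a cs \<Longrightarrow> \<exists>x. (\<Sum>c\<leftarrow>cs. (- \<rho>) ^ c) = (- \<rho>) ^ a * x \<and> - 1 < x \<and> x < 1 + \<rho>"
proof (induction cs arbitrary: a)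
  case Nil
  then show ?case
    using rho_bounds by (intro exI[of _ 0]) auto
next
  case (Cons c cs)
  then obtain x where x: "(\<Sum>c\<leftarrow>cs. (- \<rho>) ^ c) = (- \<rho>) ^ (c + 2) * x" "- 1 < x" "x < 1 + \<rho>"
    using Cons.IH[of "c + 2"] by auto
  define y where "y = 1 + \<rho> * \<rho> * x"
  from Cons.prems obtain j where j: "c = a + j"
    by (auto simp: le_iff_add)
  have sum: "(\<Sum>c\<leftarrow>c # cs. (- \<rho>) ^ c) = (- \<rho>) ^ a * ((- \<rho>) ^ j * y)"
    using x(1) by (simp add: j y_def power_add algebra_simps power2_eq_square)
  have y0: "\<rho> < y" and y1: "y < 1 + \<rho>"
    using rho_square_times_bounds[OF x(2,3)] by (simp_all add: y_def)
  \<comment> \<open>For \<open>j > 0\<close> the factor \<open>\<rho>\<^sup>j \<le> \<rho>\<close> brings the absolute value below \<open>\<rho> (1 + \<rho>) = 1\<close>.\<close>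
  have "- 1 < (- \<rho>) ^ j * y \<and> (- \<rho>) ^ j * y < 1 + \<rho>"
  proof (cases j)
    case 0
    then show ?thesis
      using y0 y1 rho_bounds by auto
  next
    case (Suc i)
    have "\<bar>(- \<rho>) ^ j * y\<bar> = \<rho> ^ i * (\<rho> * y)"
      using rho_bounds y0 by (simp add: Suc abs_mult power_abs)
    also have "\<dots> \<le> 1 * (\<rho> * y)"
      using rho_bounds y0 by (intro mult_right_mono power_le_one) auto
    also have "\<dots> < \<rho> * (1 + \<rho>)"
      using rho_bounds y1 by simp
    also have "\<dots> = 1"
      using rho_square by (simp only: distrib_left)
    finally show ?thesis
      using rho_bounds by (auto simp: abs_less_iff)
  qed
  with sum show ?case
    by blast
qed

text \<open>
  Exponents from 2 on give an error between \<open>-\<rho>\<close> and \<open>1 - \<rho>\<close>, an open interval of length 1; adding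
  \<open>1/\<phi> = \<rho>\<close> moves it to the fractional parts, which explains the \<open>k + 1\<close> under the floor.
\<close>

lemma floor_divide_golden_ratio:
  assumes "sparse 2 cs"
  shows "\<lfloor>(real (fib_sum cs) + 1) / golden_ratio\<rfloor> = int (lowered_sum cs)"
proof -
  obtain x where x: "(\<Sum>c\<leftarrow>cs. (- \<rho>) ^ c) = (- \<rho>) ^ 2 * x" "- 1 < x" "x < 1 + \<rho>"
    using sparse_power_sum[OF assms] by blast
  have "sparse 1 cs"
    using assms sparse_mono[of 2 cs 1] by simp
  then have diff: "(real (fib_sum cs) + 1) / golden_ratio - real (lowered_sum cs) = \<rho> - \<rho> * \<rho> * x"
    using lowered_sum_error[of cs] x(1)
    by (simp add: \<rho>_def add_divide_distrib power2_eq_square)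
  show ?thesis
    using diff rho_square_times_bounds[OF x(2,3)] by (intro floor_unique) auto
qed

section \<open>Raising the indices\<close>

lemma sparse_map_add [simp]: "sparse (a + j) (map (\<lambda>c. c + j) cs) \<longleftrightarrow> sparse a cs"
proof (induction cs arbitrary: a)
  case (Cons c cs)
  have "sparse (c + j + 2) (map (\<lambda>c. c + j) cs) \<longleftrightarrow> sparse (c + 2) cs"
    using Cons.IH[of "c + 2"] by (simp only: ac_simps)
  then show ?case
    by simp
qed simp

lemma sparse_add_iff: "sparse (a + j) ds \<longleftrightarrow> (\<exists>cs. sparse a cs \<and> ds = map (\<lambda>c. c + j) cs)"
proof
  assume ds: "sparse (a + j) ds"
  have "j \<le> d" if "sparse b ds" "j \<le> b" "d \<in> set ds" for b d
    using that by (induction ds arbitrary: b) fastforce+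
  with ds have "ds = map (\<lambda>c. c + j) (map (\<lambda>d. d - j) ds)"
    by (auto simp: comp_def intro!: map_idI[symmetric])
  then show "\<exists>cs. sparse a cs \<and> ds = map (\<lambda>c. c + j) cs"
    using ds sparse_map_add[of a j "map (\<lambda>d. d - j) ds"] by metis
qed auto

text \<open>This is \<open>F\<^sub>c\<^sub>+\<^sub>j = F\<^sub>j\<^sub>+\<^sub>1 F\<^sub>c + F\<^sub>j F\<^sub>c\<^sub>-\<^sub>1\<close>, summed over the list.\<close>

lemma fib_sum_raise:
  "sparse 1 cs \<Longrightarrow>
     fib_sum (map (\<lambda>c. c + j) cs) = fib (Suc j) * fib_sum cs + fib j * lowered_sum cs"
proof (induction cs)
  case (Cons c cs)
  then obtain n where "c = Suc n"
    by (cases c) auto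
  moreover have "sparse 1 cs"
    using Cons.prems sparse_mono[of "c + 2" cs 1] by auto
  ultimately show ?case
    using Cons.IH fib_add[of n j] by (simp add: algebra_simps)
qed simp

lemma divot_Suc_iff_raise:
  "n > 0 \<and> divot (n + 1) \<longleftrightarrow>
     (\<exists>cs. sparse 2 cs \<and> cs \<noteq> [] \<and> n = fib_sum (map (\<lambda>c. c + 3) cs) - 1)"
proof
  assume "n > 0 \<and> divot (n + 1)"
  then obtain cs where cs: "sparse 2 cs" "zeck (n + 1) = map (\<lambda>c. c + 3) cs"
    using divot_Suc_iff[of n] sparse_add_iff[of 2 3 "zeck (n + 1)"] by auto
  then have sum: "n + 1 = fib_sum (map (\<lambda>c. c + 3) cs)"
    using fib_sum_zeck[of "n + 1"] by simp
  then have "cs \<noteq> []"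
    by auto
  moreover have "n = fib_sum (map (\<lambda>c. c + 3) cs) - 1"
    using sum by linarith
  ultimately show "\<exists>cs. sparse 2 cs \<and> cs \<noteq> [] \<and> n = fib_sum (map (\<lambda>c. c + 3) cs) - 1"
    using cs(1) by blast
next
  assume "\<exists>cs. sparse 2 cs \<and> cs \<noteq> [] \<and> n = fib_sum (map (\<lambda>c. c + 3) cs) - 1"
  then obtain cs where cs: "sparse 2 cs" "cs \<noteq> []" "n = fib_sum (map (\<lambda>c. c + 3) cs) - 1"
    by blast
  then have s: "sparse 5 (map (\<lambda>c. c + 3) cs)"
    using sparse_map_add[of 2 3 cs] by simp
  then have "fib_sum (map (\<lambda>c. c + 3) cs) > 0"
    using cs(2) by (intro fib_sum_pos sparse_mono[OF s]) simp_all
  then have "n + 1 = fib_sum (map (\<lambda>c. c + 3) cs)"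
    using cs(3) by linarith
  then have "zeck (n + 1) = map (\<lambda>c. c + 3) cs"
    using zeck_fib_sum sparse_mono[OF s, of 2] by simp
  with s have "sparse 5 (zeck (n + 1))"
    by (simp only:)
  \<comment> \<open>The partition of 1 is \<open>[2]\<close>, so \<open>n = 0\<close> is excluded.\<close>
  moreover from this have "n > 0"
    by (cases n) simp_all
  ultimately show "n > 0 \<and> divot (n + 1)"
    using divot_Suc_iff[of n] by simp
qed

lemma peak_Suc_iff_raise:
  "n > 0 \<and> peak (n + 1) \<longleftrightarrow> (\<exists>cs. sparse 2 cs \<and> n = 3 + fib_sum (map (\<lambda>c. c + 4) cs))"
proof -
  have fib4: "fib 4 = 3"
    by (simp add: numeral_eq_Suc)
  have "n > 0 \<and> peak (n + 1) \<longleftrightarrow> (\<exists>ds. zeck n = 4 # ds)"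
    using peak_Suc_iff[of n] by (cases "n = 0") auto
  also have "\<dots> \<longleftrightarrow> (\<exists>ds. sparse 2 (4 # ds) \<and> n = fib_sum (4 # ds))"
    by (metis fib_sum_zeck sparse_zeck zeck_fib_sum)
  also have "\<dots> \<longleftrightarrow> (\<exists>ds. sparse (2 + 4) ds \<and> n = 3 + fib_sum ds)"
    by (simp add: fib4)
  finally show ?thesis
    unfolding sparse_add_iff by blast
qed

section \<open>Divots, peaks and monotone runs\<close>

lemma S2_eq: "S2 = {int (fib_sum (map (\<lambda>c. c + 3) cs) - 1) |cs. sparse 2 cs \<and> cs \<noteq> []}"
proof -
  have val: "2 * \<lfloor>(real (fib_sum cs) + 1) / golden_ratio\<rfloor> + 3 * int (fib_sum cs) - 1
             = int (fib_sum (map (\<lambda>c. c + 3) cs) - 1)" if "sparse 2 cs" "cs \<noteq> []" for cs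
    using that fib_sum_pos[of cs] sparse_mono[of 2 cs 1] fib_sum_raise[of cs 3]
    by (simp add: floor_divide_golden_ratio numeral_eq_Suc of_nat_diff)
  have index: "k \<ge> 1 \<longleftrightarrow> (\<exists>cs. sparse 2 cs \<and> cs \<noteq> [] \<and> k = int (fib_sum cs))" for k :: int
  proof
    assume "k \<ge> 1"
    then show "\<exists>cs. sparse 2 cs \<and> cs \<noteq> [] \<and> k = int (fib_sum cs)"
      using sparse_zeck fib_sum_zeck[of "nat k"]
      by (intro exI[of _ "zeck (nat k)"]) (auto simp del: fib_sum_zeck)
  qed (use fib_sum_pos in fastforce)
  show ?thesis
    unfolding S2_def index using val by (auto; metis of_int_of_nat_eq)
qed

lemma S3_eq: "S3 = {int (3 + fib_sum (map (\<lambda>c. c + 4) cs)) |cs. sparse 2 cs}"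
proof -
  have val: "3 * \<lfloor>real (fib_sum cs) / golden_ratio + golden_ratio\<rfloor> + 5 * int (fib_sum cs)
             = int (3 + fib_sum (map (\<lambda>c. c + 4) cs))" if "sparse 2 cs" for cs
  proof -
    \<comment> \<open>\<open>\<phi> = 1/\<phi> + 1\<close> turns this floor into the one computed above.\<close>
    have "real (fib_sum cs) / golden_ratio + golden_ratio
          = (real (fib_sum cs) + 1) / golden_ratio + 1"
      by (subst (2) golden_ratio_eq) (simp add: \<rho>_def add_divide_distrib)
    then show ?thesis
      using that sparse_mono[of 2 cs 1] fib_sum_raise[of cs 4]
      by (simp add: floor_divide_golden_ratio numeral_eq_Suc)
  qed
  have index: "k \<ge> 0 \<longleftrightarrow> (\<exists>cs. sparse 2 cs \<and> k = int (fib_sum cs))" for k :: int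
    using sparse_zeck fib_sum_zeck by (metis of_nat_0_le_iff zero_le_imp_eq_int)
  show ?thesis
    unfolding S3_def index using val by (auto; metis of_int_of_nat_eq)
qed

theorem theorem1p6:
  "\<not> (\<exists>n :: nat. n > 0 \<and>
        (L n < L (n + 1) \<and> L (n + 1) < L (n + 2) \<or>
         L n > L (n + 1) \<and> L (n + 1) > L (n + 2))) \<and>
   {int n |n :: nat. n > 0 \<and> divot (n + 1)} = S2 \<and>
   {int n |n :: nat. n > 0 \<and> peak (n + 1)} = S3"
proof (intro conjI)
  have rises: "\<not> L (Suc n) < L (Suc (Suc n))" if "n > 0" "L n < L (Suc n)" for n
    using that L_less_Suc_iff[of n] L_less_Suc_iff[of "Suc n"] by simp
  have falls: "L (Suc n) < L (Suc (Suc n))" if "n > 0" "L (Suc n) < L n" for n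
    using that L_Suc_less_iff[of n] L_less_Suc_iff[of "Suc n"]
      sparse_mono[of 5 "zeck (Suc n)" 4] by simp
  show "\<not> (\<exists>n :: nat. n > 0 \<and>
        (L n < L (n + 1) \<and> L (n + 1) < L (n + 2) \<or>
         L n > L (n + 1) \<and> L (n + 1) > L (n + 2)))"
    using rises falls by (metis Suc_eq_plus1 add_2_eq_Suc' less_asym)
  show "{int n |n :: nat. n > 0 \<and> divot (n + 1)} = S2"
    unfolding S2_eq divot_Suc_iff_raise by blast
  show "{int n |n :: nat. n > 0 \<and> peak (n + 1)} = S3"
    unfolding S3_eq peak_Suc_iff_raise by blast
qed

end
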